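(* The operation $\star$ on $\mathbf{L}$ cannot be obtained by $\curlyvee$; that is, for any binary operation $\ast$ on $I=[0,1]$ and any $t$-conorm $\triangledown$ on $I$, there exist $f,g\in\mathbf{L}$ such that $f\star g\neq f\curlyvee g$, where $\curlyvee$ is the operation on $\mathbf{M}$ determined by $\ast$ and $\triangledown$.
   Context: Let $I=[0,1]$, let $\mathbf{M}$ be the set of all functions $f:I\to I$, and let $\vee,\wedge$ be max and min on $I$. A function $f\in\mathbf{M}$ is normal if $\sup_{x\in I}f(x)=1$, and convex if $f(y)\ge f(x)\wedge f(z)$ whenever $0\le x\le y\le z\le 1$. $\mathbf{L}$ is the set of all normal and convex $f\in\mathbf{M}$. For $B\subseteq I$, $\mathbf{1}_B$ is the characteristic function of $B$. A $t$-conorm on $I$ is a binary operation $I^2\to I$ that is commutative, associative, increasing in each argument, and has neutral element $0$. A binary operation $\ast$ on $I$ is an arbitrary map $I^2\to I$. Given $\ast$ and a $t$-conorm $\triangledown$, define for $f,g\in\mathbf{M}$ $$(f\curlyvee g)(x)=\sup\{f(y)\ast g(z)\mid y\,\triangledown\, z=x\}.$$ For $f\in\mathbf{M}$: $f^L(x)=\sup\{f(y)\mid y\le x\}$ and $f^R(x)=\sup\{f(y)\mid y\ge x\}$. For $f,g\in\mathbf{L}$: $\eta_{f,g}=\inf\{x\in I\mid f^L(x)=1\}\wedge\inf\{x\in I\mid g^L(x)=1\}$, $\xi_{f,g}=\sup\{x\in I\mid f^R(x)=1\}\wedge\sup\{x\in I\mid g^R(x)=1\}$ (one has $\eta_{f,g}\le\xi_{f,g}$).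 The operation $\star:\mathbf{L}^2\to\mathbf{M}$: if $f=\mathbf{1}_{\{1\}}$ then $f\star g=g\star f=g$; if $g=\mathbf{1}_{\{1\}}$ then $f\star g=g\star f=f$; if $f\ne\mathbf{1}_{\{1\}}$ and $g\neq\mathbf{1}_{\{1\}}$ then $$(f\star g)(t)=\begin{cases} f^L(t)\vee g^L(t), & t\in[0,\eta_{f,g}),\\ 1,& t\in[\eta_{f,g},\xi_{f,g}),\\ f^R(\xi_{f,g})\wedge g^R(\xi_{f,g}), & t=\xi_{f,g},\\ 0,& t\in(\xi_{f,g},1].\end{cases}$$ *)

theory Defs
  imports Complex_Main "HOL-Library.FuncSet" "HOL-Library.Indicator_Function"
begin

text \<open>
  Functions on the unit interval are modelled as extensional functions, so that HOL equality
  of members of \<open>MM\<close> is equality of maps from I to I. All suprema and infima below are taken in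
  \<^typ>\<open>real\<close> over bounded sets which are non-empty whenever the arguments lie in the
  intended domains, hence they agree with those in the complete lattice I.
\<close>

definition I :: "real set" where
  "I = {0..1}"

definition MM :: "(real \<Rightarrow> real) set" where
  "MM = (I \<rightarrow>\<^sub>E I)"

definition normal_fun :: "(real \<Rightarrow> real) \<Rightarrow> bool" where
  "normal_fun f \<longleftrightarrow> (SUP x\<in>I. f x) = 1"

definition convex_fun :: "(real \<Rightarrow> real) \<Rightarrow> bool" where
  "convex_fun f \<longleftrightarrow> (\<forall>x y z. 0 \<le> x \<and> x \<le> y \<and> y \<le> z \<and> z \<le> 1 \<longrightarrow> f y \<ge> min (f x) (f z))"

definition LL :: "(real \<Rightarrow> real) set" where
  "LL = {f \<in> MM. normal_fun f \<and> convex_fun f}"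

definition char_fun :: "real set \<Rightarrow> real \<Rightarrow> real" where
  "char_fun B = restrict (indicator B) I"

definition binary_operation :: "(real \<Rightarrow> real \<Rightarrow> real) \<Rightarrow> bool" where
  "binary_operation p \<longleftrightarrow> p \<in> I \<rightarrow> I \<rightarrow> I"

definition t_conorm :: "(real \<Rightarrow> real \<Rightarrow> real) \<Rightarrow> bool" where
  "t_conorm S \<longleftrightarrow> binary_operation S
     \<and> (\<forall>x\<in>I. \<forall>y\<in>I. S x y = S y x)
     \<and> (\<forall>x\<in>I. \<forall>y\<in>I. \<forall>z\<in>I. S (S x y) z = S x (S y z))
     \<and> (\<forall>x\<in>I. mono_on I (\<lambda>y. S x y) \<and> mono_on I (\<lambda>y. S y x))
     \<and> (\<forall>x\<in>I. S 0 x = x \<and> S x 0 = x)"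

definition curlyvee ::
  "(real \<Rightarrow> real \<Rightarrow> real) \<Rightarrow> (real \<Rightarrow> real \<Rightarrow> real) \<Rightarrow>
   (real \<Rightarrow> real) \<Rightarrow> (real \<Rightarrow> real) \<Rightarrow> real \<Rightarrow> real" where
  "curlyvee p S f g =
     (\<lambda>x\<in>I. Sup {p (f y) (g z) | y z. y \<in> I \<and> z \<in> I \<and> S y z = x})"

definition left_env :: "(real \<Rightarrow> real) \<Rightarrow> real \<Rightarrow> real" where
  "left_env f = (\<lambda>x\<in>I. Sup {f y | y. y \<in> I \<and> y \<le> x})"

definition right_env :: "(real \<Rightarrow> real) \<Rightarrow> real \<Rightarrow> real" where
  "right_env f = (\<lambda>x\<in>I. Sup {f y | y. y \<in> I \<and> y \<ge> x})"

definition eta :: "(real \<Rightarrow> real) \<Rightarrow> (real \<Rightarrow> real) \<Rightarrow> real" where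
  "eta f g = min (Inf {x \<in> I. left_env f x = 1}) (Inf {x \<in> I. left_env g x = 1})"

definition xi :: "(real \<Rightarrow> real) \<Rightarrow> (real \<Rightarrow> real) \<Rightarrow> real" where
  "xi f g = min (Sup {x \<in> I. right_env f x = 1}) (Sup {x \<in> I. right_env g x = 1})"

definition star :: "(real \<Rightarrow> real) \<Rightarrow> (real \<Rightarrow> real) \<Rightarrow> real \<Rightarrow> real" where
  "star f g =
     (if f = char_fun {1} then g
      else if g = char_fun {1} then f
      else (\<lambda>t\<in>I.
        if t < eta f g then max (left_env f t) (left_env g t)
        else if t < xi f g then 1
        else if t = xi f g then min (right_env f (xi f g)) (right_env g (xi f g))
        else 0))"

end

theory Submission imports Defs begin

text \<open>
  Let \<open>f = \<one>\<^bsub>{0}\<^esub>\<close> and \<open>g = \<one>\<^bsub>{1}\<^esub>\<close>. As \<open>g\<close> is neutral for \<open>\<star>\<close>, \<open>f \<curlyvee> g\<close> and \<open>g \<curlyvee> f\<close> should both be \<open>f\<close>.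
  Only \<open>(0, 0)\<close> is mapped to 0 by a t-conorm, so the value of \<open>f \<curlyvee> g\<close> at 0 is \<open>p 1 0\<close>,
  which should be \<open>f 0 = 1\<close>. But \<open>(1, 1)\<close> is mapped to 1, so the value of \<open>g \<curlyvee> f\<close>
  at 1 is at least \<open>p (g 1) (f 1) = p 1 0 = 1\<close>, whereas \<open>f 1 = 0\<close>.
\<close>

text \<open>The supremum is attained at \<open>a\<close>. For convexity, a positive minimum forces
  \<open>x = z = a\<close>, hence \<open>y = a\<close>.\<close>

lemma char_fun_singleton_in_LL:
  assumes "a \<in> I"
  shows "char_fun {a} \<in> LL"
proof -
  have "(SUP x\<in>I. char_fun {a} x) = 1"
    using assms by (intro cSup_eq_maximum) (auto simp: char_fun_def indicator_def image_iff)
  then show ?thesis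
    by (auto simp: LL_def MM_def normal_fun_def convex_fun_def char_fun_def I_def indicator_def)
qed

lemma star_char_fun_one:
  "star f (char_fun {1}) = f" "star (char_fun {1}) g = g"
  by (simp_all add: star_def)

text \<open>Compare with the neutral element: \<open>y = S y 0 <= S y z\<close> by monotonicity, and
  symmetrically for \<open>z\<close>.\<close>

lemma t_conorm_upper:
  assumes S: "t_conorm S" and yz: "y \<in> I" "z \<in> I"
  shows "y \<le> S y z" "z \<le> S y z"
proof -
  have 0: "0 \<in> I" "0 \<le> y" "0 \<le> z" using yz by (simp_all add: I_def)
  have "mono_on I (\<lambda>z. S y z)" "mono_on I (\<lambda>y. S y z)" "S y 0 = y" "S 0 z = z"
    using S yz by (auto simp: t_conorm_def)
  then show "y \<le> S y z" "z \<le> S y z"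
    using 0 yz by (metis mono_onD)+
qed

lemma t_conorm_eq_0_iff:
  assumes S: "t_conorm S" and yz: "y \<in> I" "z \<in> I"
  shows "S y z = 0 \<longleftrightarrow> y = 0 \<and> z = 0"
  using t_conorm_upper[OF S yz] S yz by (auto simp: t_conorm_def I_def)

lemma t_conorm_1_1:
  assumes "t_conorm S"
  shows "S 1 1 = 1"
proof (rule antisym)
  show "S 1 1 \<le> 1"
    using assms by (auto simp: t_conorm_def binary_operation_def I_def Pi_def)
  show "1 \<le> S 1 1"
    using t_conorm_upper[OF assms, of 1 1] by (simp add: I_def)
qed

lemma curlyvee_at_0:
  assumes "t_conorm S"
  shows "curlyvee p S f g 0 = p (f 0) (g 0)"
proof -
  have "{p (f y) (g z) | y z. y \<in> I \<and> z \<in> I \<and> S y z = 0} = {p (f 0) (g 0)}"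
    using t_conorm_eq_0_iff[OF assms] by (force simp: I_def)
  then show ?thesis by (simp add: curlyvee_def I_def)
qed

lemma curlyvee_ge:
  assumes p: "binary_operation p" and "f \<in> MM" "g \<in> MM"
    and "y \<in> I" "z \<in> I" "S y z \<in> I"
  shows "p (f y) (g z) \<le> curlyvee p S f g (S y z)"
proof -
  \<comment> \<open>A real \<open>Sup\<close> is known to dominate its members only for bounded
    sets; here all values of \<open>p\<close> lie in \<open>I\<close>.\<close>
  have "bdd_above {p (f v) (g w) | v w. v \<in> I \<and> w \<in> I \<and> S v w = S y z}"
  proof (rule bdd_aboveI)
    fix x assume "x \<in> {p (f v) (g w) | v w. v \<in> I \<and> w \<in> I \<and> S v w = S y z}"
    then obtain v w where "x = p (f v) (g w)" "v \<in> I" "w \<in> I" by blast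
    moreover have "f v \<in> I" "g w \<in> I"
      using assms(2,3) \<open>v \<in> I\<close> \<open>w \<in> I\<close> by (auto simp: MM_def)
    ultimately have "x \<in> I"
      using p by (auto simp: binary_operation_def)
    then show "x \<le> 1" by (simp add: I_def)
  qed
  then show ?thesis
    using assms by (auto simp: curlyvee_def intro!: cSup_upper)
qed

theorem corollary5p1:
  fixes p S :: "real \<Rightarrow> real \<Rightarrow> real"
  assumes "binary_operation p" and "t_conorm S"
  shows "\<exists>f\<in>LL. \<exists>g\<in>LL. star f g \<noteq> curlyvee p S f g"
proof (rule ccontr)
  assume "\<not> ?thesis"
  then have eq: "star f g = curlyvee p S f g" if "f \<in> LL" "g \<in> LL" for f g
    using that by blast
  let ?f = "char_fun {0}" and ?g = "char_fun {1}"
  have I01: "0 \<in> I" "1 \<in> I" by (simp_all add: I_def)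
  have L: "?f \<in> LL" "?g \<in> LL"
    using I01 by (simp_all add: char_fun_singleton_in_LL)
  have vals: "?f 0 = 1" "?f 1 = 0" "?g 0 = 0" "?g 1 = 1"
    by (simp_all add: char_fun_def I_def)
  have "p 1 0 = curlyvee p S ?f ?g 0"
    by (simp add: curlyvee_at_0[OF assms(2)] vals)
  also have "\<dots> = 1"
    using eq[OF L] vals(1) by (simp add: star_char_fun_one)
  finally have "p 1 0 = 1" .
  \<comment> \<open>With the arguments swapped, the pair \<open>(1, 1)\<close> gives
    \<open>p 1 0\<close> again; the original order would give \<open>p 0 1\<close>.\<close>
  moreover have "p 1 0 \<le> curlyvee p S ?g ?f 1"
    using curlyvee_ge[of p ?g ?f 1 1 S] assms(1) L I01
    by (simp add: t_conorm_1_1[OF assms(2)] vals LL_def)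
  moreover have "curlyvee p S ?g ?f 1 = 0"
    using eq[OF L(2,1)] vals(2) by (simp add: star_char_fun_one)
  ultimately show False by simp
qed

end
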